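(* Let $\gamma>0$ and $g_0(z)=-\mathrm{Log}(1-z)$ for $z\in\mathbb{D}$. (i) Both of the Cesàro operators $C\colon A^{-\gamma}\to A^{-\gamma}$ and $C\colon A^{-\gamma}_0\to A^{-\gamma}_0$ fail to have closed range. (ii) Both of the operators $V_{g_0}\colon A^{-\gamma}\to A^{-\gamma}$ and $V_{g_0}\colon A^{-\gamma}_0\to A^{-\gamma}_0$ fail to have closed range.
   Context: $\mathbb{D}$ is the open unit disc in $\mathbb{C}$ and $H(\mathbb{D})$ is the space of analytic functions on $\mathbb{D}$. For $\gamma>0$, $A^{-\gamma}:=\{f\in H(\mathbb{D}): \|f\|_{-\gamma}:=\sup_{z\in\mathbb{D}}(1-|z|)^\gamma|f(z)|<\infty\}$ and $A^{-\gamma}_0:=\{f\in H(\mathbb{D}): \lim_{|z|\to1^-}(1-|z|)^\gamma|f(z)|=0\}$, both Banach spaces with norm $\|\cdot\|_{-\gamma}$. For $f\in H(\mathbb{D})$, the Cesàro operator is $(Cf)(0):=f(0)$, $(Cf)(z):=\frac1z\int_0^z\frac{f(\xi)}{1-\xi}\,d\xi$ for $z\in\mathbb{D}\setminus\{0\}$, and $(V_{g_0}f)(z):=\int_0^zf(\xi)g_0'(\xi)\,d\xi=\int_0^z\frac{f(\xi)}{1-\xi}\,d\xi$ for $z\in\mathbb{D}$. These operators are known to map each of $A^{-\gamma}$ and $A^{-\gamma}_0$ continuously into itself. *)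

theory Defs
  imports "HOL-Complex_Analysis.Complex_Analysis"
begin

text \<open>A function on the unit disc is represented by its extension by \<open>0\<close> to the whole plane, so that
  equality of functions on the disc is equality in HOL, and \<open>H_disc\<close> is closed under
  pointwise linear combinations.\<close>

definition H_disc :: "(complex \<Rightarrow> complex) set" where
  "H_disc = {f. f holomorphic_on ball 0 1 \<and> (\<forall>z. z \<notin> ball 0 1 \<longrightarrow> f z = 0)}"

definition growth_norm :: "real \<Rightarrow> (complex \<Rightarrow> complex) \<Rightarrow> real" where
  "growth_norm \<gamma> f = (SUP z\<in>ball 0 1. (1 - norm z) powr \<gamma> * norm (f z))"

definition growth_space :: "real \<Rightarrow> (complex \<Rightarrow> complex) set" where
  "growth_space \<gamma> =
     {f \<in> H_disc. bdd_above ((\<lambda>z. (1 - norm z) powr \<gamma> * norm (f z)) ` ball 0 1)}"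

text \<open>The filter below expresses \<open>\<bar>z\<bar> \<longrightarrow> 1\<close> from below, uniformly in the argument of \<open>z\<close>.\<close>

definition growth_space0 :: "real \<Rightarrow> (complex \<Rightarrow> complex) set" where
  "growth_space0 \<gamma> =
     {f \<in> H_disc. ((\<lambda>z. (1 - norm z) powr \<gamma> * norm (f z)) \<longlongrightarrow> 0) (filtercomap norm (at_left 1))}"

text \<open>\<open>Metric_space\<close> requires nonnegativity of the distance for all arguments, also outside the
  carrier, where the supremum defining \<open>growth_norm\<close> is an unspecified real number; hence the case
  distinction.\<close>

definition growth_dist :: "real \<Rightarrow> (complex \<Rightarrow> complex) \<Rightarrow> (complex \<Rightarrow> complex) \<Rightarrow> real" where
  "growth_dist \<gamma> f g =
     (if f \<in> growth_space \<gamma> \<and> g \<in> growth_space \<gamma> then growth_norm \<gamma> (\<lambda>z. f z - g z) else 0)"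

definition cesaro :: "(complex \<Rightarrow> complex) \<Rightarrow> complex \<Rightarrow> complex" where
  "cesaro f z =
     (if z = 0 then f 0
      else if z \<in> ball 0 1 then (1 / z) * contour_integral (linepath 0 z) (\<lambda>\<xi>. f \<xi> / (1 - \<xi>))
      else 0)"

definition volterra :: "(complex \<Rightarrow> complex) \<Rightarrow> (complex \<Rightarrow> complex) \<Rightarrow> complex \<Rightarrow> complex" where
  "volterra g f z =
     (if z \<in> ball 0 1 then contour_integral (linepath 0 z) (\<lambda>\<xi>. f \<xi> * deriv g \<xi>) else 0)"

definition g0 :: "complex \<Rightarrow> complex" where
  "g0 z = - Ln (1 - z)"


lemma deriv_g0:
  assumes "z \<in> ball 0 1"
  shows "deriv g0 z = 1 / (1 - z)"
proof -
  have "Re z < 1"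
    using assms complex_Re_le_cmod[of z] by simp
  then have "1 - z \<notin> \<real>\<^sub>\<le>\<^sub>0"
    by (auto simp: complex_nonpos_Reals_iff)
  then have "((\<lambda>z. - Ln (1 - z)) has_field_derivative 1 / (1 - z)) (at z)"
    by (auto intro!: derivative_eq_intros simp: field_simps)
  then show ?thesis
    unfolding g0_def by (rule DERIV_imp_deriv)
qed

lemma closed_segment_0_ball: "y \<in> ball 0 1 \<Longrightarrow> closed_segment 0 y \<subseteq> ball (0::complex) 1"
  by (simp add: closed_segment_subset)

lemma volterra_g0_eq:
  assumes "z \<in> ball 0 1"
  shows "volterra g0 f z = contour_integral (linepath 0 z) (\<lambda>\<xi>. f \<xi> / (1 - \<xi>))"
proof -
  have "contour_integral (linepath 0 z) (\<lambda>\<xi>. f \<xi> * deriv g0 \<xi>)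
      = contour_integral (linepath 0 z) (\<lambda>\<xi>. f \<xi> / (1 - \<xi>))"
    using closed_segment_0_ball[OF assms]
    by (intro contour_integral_cong) (auto simp: deriv_g0)
  then show ?thesis
    using assms by (simp add: volterra_def)
qed

lemma holomorphic_quotient:
  assumes "f \<in> H_disc"
  shows "(\<lambda>\<xi>. f \<xi> / (1 - \<xi>)) holomorphic_on ball 0 1"
  using assms by (auto simp: H_disc_def intro!: holomorphic_intros)

lemma volterra_g0_deriv:
  assumes f: "f \<in> H_disc" and z: "z \<in> ball 0 1"
  shows "(volterra g0 f has_field_derivative f z / (1 - z)) (at z)"
proof -
  let ?h = "\<lambda>\<xi>. f \<xi> / (1 - \<xi>)"
  have hol: "?h holomorphic_on ball 0 1"
    by (rule holomorphic_quotient[OF f])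
  have "((\<lambda>x. contour_integral (linepath 0 x) ?h) has_field_derivative ?h z) (at z)"
  proof (rule triangle_contour_integrals_starlike_primitive[of "ball 0 1"])
    show "continuous_on (ball 0 1) ?h"
      using hol by (rule holomorphic_on_imp_continuous_on)
    fix b c :: complex assume bc: "closed_segment b c \<subseteq> ball 0 1"
    then have "b \<in> ball 0 1" "c \<in> ball 0 1" by auto
    then have "convex hull {0, b, c} \<subseteq> ball 0 1"
      by (intro hull_minimal) auto
    then have "?h holomorphic_on convex hull {0, b, c}"
      using hol holomorphic_on_subset by blast
    then have "(?h has_contour_integral 0) (linepath 0 b +++ linepath b c +++ linepath c 0)"
      by (rule Cauchy_theorem_triangle)
    then show "contour_integral (linepath 0 b) ?h + contour_integral (linepath b c) ?h
        + contour_integral (linepath c 0) ?h = 0"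
      by (rule has_chain_integral_chain_integral3)
  qed (use z closed_segment_0_ball in auto)
  then show ?thesis
    by (rule has_field_derivative_transform_within_open[of _ _ _ "ball 0 1"])
      (use z in \<open>auto simp: volterra_g0_eq\<close>)
qed

lemma volterra_g0_H_disc:
  assumes "f \<in> H_disc"
  shows "volterra g0 f \<in> H_disc"
proof -
  have "volterra g0 f holomorphic_on ball 0 1"
    using volterra_g0_deriv[OF assms] unfolding holomorphic_on_open[OF open_ball] by blast
  then show ?thesis
    by (auto simp: H_disc_def volterra_def)
qed

lemma cesaro_eq:
  assumes "z \<in> ball 0 1" "z \<noteq> 0"
  shows "cesaro f z = volterra g0 f z / z"
  using assms by (simp add: cesaro_def volterra_g0_eq)

lemma cesaro_H_disc:
  assumes "f \<in> H_disc"
  shows "cesaro f \<in> H_disc"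
proof -
  let ?V = "volterra g0 f"
  have V0: "?V 0 = 0" by (simp add: volterra_def)
  have dV: "deriv ?V 0 = f 0"
    using DERIV_imp_deriv[OF volterra_g0_deriv[OF assms, of 0]] by simp
  have "?V holomorphic_on ball 0 1"
    using volterra_g0_H_disc[OF assms] by (simp add: H_disc_def)
  then have "(\<lambda>z. if z = 0 then deriv ?V 0 else (?V z - ?V 0) / (z - 0)) holomorphic_on ball 0 1"
    by (rule pole_lemma) auto
  then have "cesaro f holomorphic_on ball 0 1"
    by (rule holomorphic_transform) (use V0 dV in \<open>auto simp: cesaro_eq cesaro_def[of f 0]\<close>)
  then show ?thesis
    by (auto simp: H_disc_def cesaro_def)
qed

lemma H_disc_bounded_cball:
  assumes "f \<in> H_disc" "r < 1"
  obtains K where "K \<ge> 0" "\<And>z. norm z \<le> r \<Longrightarrow> norm (f z) \<le> K"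
proof -
  have "f holomorphic_on cball 0 r"
    using assms by (auto simp: H_disc_def elim!: holomorphic_on_subset)
  then have "bounded (f ` cball 0 r)"
    by (intro compact_imp_bounded compact_continuous_image holomorphic_on_imp_continuous_on) auto
  then obtain K where "K > 0" "\<forall>x\<in>f ` cball 0 r. norm x \<le> K"
    unfolding bounded_pos by blast
  then show thesis
    by (intro that[of K]) auto
qed

lemma growth_space_iff:
  "f \<in> growth_space \<gamma> \<longleftrightarrow>
     f \<in> H_disc \<and> (\<exists>M\<ge>0. \<forall>z\<in>ball 0 1. norm (f z) \<le> M * (1 - norm z) powr (-\<gamma>))"
proof -
  have eq: "(1 - norm z) powr \<gamma> * norm (f z) \<le> M \<longleftrightarrow> norm (f z) \<le> M * (1 - norm z) powr (-\<gamma>)"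
    if "z \<in> ball 0 1" for z M
    using that by (simp add: powr_minus field_simps)
  have "(\<exists>M\<ge>0. \<forall>z\<in>ball 0 1. norm (f z) \<le> M * (1 - norm z) powr (-\<gamma>))"
    if ex: "\<exists>M. \<forall>z\<in>ball 0 1. (1 - norm z) powr \<gamma> * norm (f z) \<le> M"
  proof -
    obtain M where M: "\<forall>z\<in>ball 0 1. (1 - norm z) powr \<gamma> * norm (f z) \<le> M"
      using ex by blast
    have "(1 - norm (0::complex)) powr \<gamma> * norm (f 0) \<le> M"
      using M by (meson centre_in_ball zero_less_one)
    then have "M \<ge> 0"
      using order_trans[OF norm_ge_zero[of "f 0"]] by simp
    then show ?thesis
      using M eq by blast
  qed
  moreover have "bdd_above ((\<lambda>z. (1 - norm z) powr \<gamma> * norm (f z)) ` ball 0 1) \<longleftrightarrow>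
      (\<exists>M. \<forall>z\<in>ball 0 1. (1 - norm z) powr \<gamma> * norm (f z) \<le> M)"
    by (auto simp: bdd_above_def)
  moreover have "\<exists>M. \<forall>z\<in>ball 0 1. (1 - norm z) powr \<gamma> * norm (f z) \<le> M"
    if "\<exists>M\<ge>0. \<forall>z\<in>ball 0 1. norm (f z) \<le> M * (1 - norm z) powr (-\<gamma>)"
    using that eq by blast
  ultimately show ?thesis
    unfolding growth_space_def mem_Collect_eq by argo
qed

lemma growth_space0_iff:
  "f \<in> growth_space0 \<gamma> \<longleftrightarrow>
     f \<in> H_disc \<and> (\<forall>e>0. \<exists>r<1. \<forall>z. r < norm z \<longrightarrow> norm z < 1 \<longrightarrow>
       norm (f z) \<le> e * (1 - norm z) powr (-\<gamma>))"
proof -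
  have eq: "(1 - norm z) powr \<gamma> * norm (f z) \<le> M \<longleftrightarrow> norm (f z) \<le> M * (1 - norm z) powr (-\<gamma>)"
    if "norm z < 1" for z M
    using that by (simp add: powr_minus field_simps)
  let ?u = "\<lambda>z. (1 - norm z) powr \<gamma> * norm (f z)"
  have ev: "eventually P (filtercomap norm (at_left 1)) \<longleftrightarrow>
      (\<exists>r<1. \<forall>z::complex. r < norm z \<longrightarrow> norm z < 1 \<longrightarrow> P z)" for P
    unfolding eventually_filtercomap eventually_at_left_field
  proof safe
    fix r :: real assume "r < 1" "\<forall>z. r < norm z \<longrightarrow> norm z < 1 \<longrightarrow> P z"
    then show "\<exists>Q. (\<exists>b<1. \<forall>y>b. y < 1 \<longrightarrow> Q y) \<and> (\<forall>x. Q (norm x) \<longrightarrow> P x)"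
      by (intro exI[of _ "\<lambda>y. r < y \<and> y < 1"]) auto
  qed blast
  have "(?u \<longlongrightarrow> 0) (filtercomap norm (at_left 1)) \<longleftrightarrow>
      (\<forall>e>0. \<exists>r<1. \<forall>z. r < norm z \<longrightarrow> norm z < 1 \<longrightarrow> ?u z < e)"
    unfolding tendsto_iff ev by (simp add: dist_norm abs_mult)
  also have "\<dots> \<longleftrightarrow> (\<forall>e>0. \<exists>r<1. \<forall>z. r < norm z \<longrightarrow> norm z < 1 \<longrightarrow> ?u z \<le> e)"
  proof
    assume R: "\<forall>e>0. \<exists>r<1. \<forall>z. r < norm z \<longrightarrow> norm z < 1 \<longrightarrow> ?u z \<le> e"
    show "\<forall>e>0. \<exists>r<1. \<forall>z. r < norm z \<longrightarrow> norm z < 1 \<longrightarrow> ?u z < e"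
    proof (intro allI impI)
      fix e :: real assume e: "e > 0"
      then have "e / 2 > 0" by simp
      with R obtain r where "r < 1" "\<forall>z. r < norm z \<longrightarrow> norm z < 1 \<longrightarrow> ?u z \<le> e / 2"
        by blast
      then show "\<exists>r<1. \<forall>z. r < norm z \<longrightarrow> norm z < 1 \<longrightarrow> ?u z < e"
        using e by (intro exI[of _ r]) fastforce
    qed
  qed (meson less_imp_le)
  finally show ?thesis
    unfolding growth_space0_def mem_Collect_eq by (simp only: eq cong: imp_cong)
qed

lemma growth_space0_split:
  assumes "f \<in> growth_space0 \<gamma>" "e > 0" "\<delta> \<ge> 0"
  obtains K where "K \<ge> 0"
    "\<And>z. z \<in> ball 0 1 \<Longrightarrow> norm (f z) \<le> e * (1 - norm z) powr (-\<gamma>) + K * (1 - norm z) powr (-\<delta>)"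
proof -
  obtain r where r: "r < 1"
    "\<And>z. r < norm z \<Longrightarrow> norm z < 1 \<Longrightarrow> norm (f z) \<le> e * (1 - norm z) powr (-\<gamma>)"
    using assms unfolding growth_space0_iff by blast
  obtain K where K: "K \<ge> 0" "\<And>z. norm z \<le> r \<Longrightarrow> norm (f z) \<le> K"
    using H_disc_bounded_cball[of f r] assms r(1) unfolding growth_space0_iff by blast
  show thesis
  proof (rule that[OF K(1)])
    fix z :: complex assume z: "z \<in> ball 0 1"
    have "1 \<le> (1 - norm z) powr (-\<delta>)"
      using z assms(3) powr_mono2'[of "-\<delta>" "1 - norm z" 1] by simp
    then have "K \<le> K * (1 - norm z) powr (-\<delta>)"
      using K(1) mult_left_mono by fastforce
    moreover have "0 \<le> e * (1 - norm z) powr (-\<gamma>)" using assms by simp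
    ultimately show "norm (f z) \<le> e * (1 - norm z) powr (-\<gamma>) + K * (1 - norm z) powr (-\<delta>)"
      using r(2)[of z] K(2)[of z] K(1) z by (cases "norm z \<le> r") auto
  qed
qed

lemma growth_space0_subset:
  assumes "\<gamma> > 0"
  shows "growth_space0 \<gamma> \<subseteq> growth_space \<gamma>"
proof
  fix f assume f: "f \<in> growth_space0 \<gamma>"
  obtain K where K: "K \<ge> 0"
    "\<And>z. z \<in> ball 0 1 \<Longrightarrow> norm (f z) \<le> 1 * (1 - norm z) powr (-\<gamma>) + K * (1 - norm z) powr (-\<gamma>)"
    using growth_space0_split[OF f, of 1 \<gamma>] assms by auto
  then have "\<forall>z\<in>ball 0 1. norm (f z) \<le> (1 + K) * (1 - norm z) powr (-\<gamma>)"
    by (auto simp: algebra_simps)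
  then show "f \<in> growth_space \<gamma>"
    using f K(1) unfolding growth_space_iff growth_space0_iff
    by (intro conjI exI[of _ "1 + K"]) auto
qed

lemma volterra_g0_bound:
  assumes f: "f \<in> H_disc" and pos: "\<gamma> > 0" "\<delta> > 0" "a \<ge> 0" "b \<ge> 0"
    and bd: "\<And>z. z \<in> ball 0 1 \<Longrightarrow>
      norm (f z) \<le> a * (1 - norm z) powr (-\<gamma>) + b * (1 - norm z) powr (-\<delta>)"
    and z: "z \<in> ball 0 1"
  shows "norm (volterra g0 f z) \<le> a / \<gamma> * (1 - norm z) powr (-\<gamma>) + b / \<delta> * (1 - norm z) powr (-\<delta>)"
proof -
  define r where "r = norm z"
  have r: "0 \<le> r" "r < 1" using z by (auto simp: r_def)
  let ?h = "\<lambda>\<xi>. f \<xi> / (1 - \<xi>)"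
  let ?G = "\<lambda>t. a / \<gamma> * (1 - t * r) powr (-\<gamma>) + b / \<delta> * (1 - t * r) powr (-\<delta>)"
  let ?G' = "\<lambda>t. r * (a * (1 - t * r) powr (-\<gamma> - 1) + b * (1 - t * r) powr (-\<delta> - 1))"
  have tr: "t * r < 1" "0 \<le> t * r" if "t \<in> {0..1}" for t
    using that r mult_left_le_one_le[of r t] by auto
  have G: "(?G' has_integral (?G 1 - ?G 0)) {0..1}"
  proof (rule fundamental_theorem_of_calculus)
    fix t :: real assume t: "t \<in> {0..1}"
    have "(?G has_real_derivative ?G' t) (at t within {0..1})"
      using tr[OF t] pos by (auto intro!: derivative_eq_intros simp: field_simps)
    then show "(?G has_vector_derivative ?G' t) (at t within {0..1})"
      by (simp add: has_real_derivative_iff_has_vector_derivative)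
  qed auto
  have "?h holomorphic_on closed_segment 0 z"
    using holomorphic_quotient[OF f] closed_segment_0_ball[OF z] holomorphic_on_subset by blast
  then have "?h contour_integrable_on linepath 0 z"
    by (intro contour_integrable_continuous_linepath holomorphic_on_imp_continuous_on)
  then have I: "((\<lambda>t. ?h (linepath 0 z t) * (z - 0)) has_integral volterra g0 f z) {0..1}"
    using has_contour_integral_integral[of ?h "linepath 0 z"] volterra_g0_eq[OF z]
    by (simp only: has_contour_integral_linepath)
  have le: "norm (?h (linepath 0 z t) * (z - 0)) \<le> ?G' t" if t: "t \<in> {0..1}" for t
  proof -
    define w where "w = linepath 0 z t"
    have w: "norm w = t * r"
      using t by (simp add: w_def linepath_def r_def)
    then have wb: "w \<in> ball 0 1" using tr[OF t] by simp
    define s where "s = 1 - t * r"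
    have s: "s > 0" using tr[OF t] by (simp add: s_def)
    have "norm (1 - w) \<ge> s"
      using norm_triangle_ineq2[of 1 w] by (simp add: w s_def)
    then have "norm (?h w) \<le> norm (f w) / s"
      using s by (simp add: norm_divide frac_le)
    also have "\<dots> \<le> (a * s powr (-\<gamma>) + b * s powr (-\<delta>)) / s"
      using bd[OF wb] s by (simp add: w s_def divide_right_mono)
    also have "\<dots> = a * s powr (-\<gamma> - 1) + b * s powr (-\<delta> - 1)"
      using s by (simp add: powr_diff add_divide_distrib)
    finally have "norm (?h w) * r \<le> (a * s powr (-\<gamma> - 1) + b * s powr (-\<delta> - 1)) * r"
      using r(1) by (rule mult_right_mono)
    then show ?thesis
      unfolding norm_mult w_def[symmetric] s_def[symmetric] diff_0_right r_def[symmetric]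
      by (simp only: mult.commute)
  qed
  have "norm (volterra g0 f z) \<le> ?G 1 - ?G 0"
    using integral_norm_bound_integral[OF has_integral_integrable[OF I] has_integral_integrable[OF G] le]
    unfolding integral_unique[OF I] integral_unique[OF G] .
  also have "\<dots> \<le> ?G 1"
    using divide_nonneg_pos[OF pos(3) pos(1)] divide_nonneg_pos[OF pos(4) pos(2)] by simp
  finally show ?thesis by (simp add: r_def)
qed

lemma volterra_g0_maps:
  assumes "\<gamma> > 0" "f \<in> growth_space \<gamma>"
  shows "volterra g0 f \<in> growth_space \<gamma>"
proof -
  obtain M where f: "f \<in> H_disc" and M: "M \<ge> 0"
    "\<And>z. z \<in> ball 0 1 \<Longrightarrow> norm (f z) \<le> M * (1 - norm z) powr (-\<gamma>)"
    using assms(2) unfolding growth_space_iff by blast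
  have "norm (volterra g0 f z) \<le> M / \<gamma> * (1 - norm z) powr (-\<gamma>)" if "z \<in> ball 0 1" for z
    using volterra_g0_bound[OF f assms(1) assms(1) M(1), of 0 z] M(2) that by simp
  then show ?thesis
    unfolding growth_space_iff using volterra_g0_H_disc[OF f] assms(1) M(1)
    by (intro conjI exI[of _ "M / \<gamma>"]) auto
qed

lemma volterra_g0_maps0:
  assumes g: "\<gamma> > 0" and f0: "f \<in> growth_space0 \<gamma>"
  shows "volterra g0 f \<in> growth_space0 \<gamma>"
  unfolding growth_space0_iff
proof (intro conjI allI impI)
  have f: "f \<in> H_disc" using f0 by (simp add: growth_space0_def)
  then show "volterra g0 f \<in> H_disc" by (rule volterra_g0_H_disc)
  fix e :: real assume e: "e > 0"
  define a where "a = e * \<gamma> / 2"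
  have a: "a > 0" using e g by (simp add: a_def)
  obtain K where K: "K \<ge> 0" "\<And>z. z \<in> ball 0 1 \<Longrightarrow>
      norm (f z) \<le> a * (1 - norm z) powr (-\<gamma>) + K * (1 - norm z) powr (-(\<gamma>/2))"
    using growth_space0_split[OF f0 a, of "\<gamma>/2"] g by auto
  define B where "B = K / (\<gamma>/2) + 1"
  have B: "B > 0" using K(1) g by (simp add: B_def add_nonneg_pos)
  define \<rho> where "\<rho> = (e / (2 * B)) powr (2/\<gamma>)"
  have \<rho>: "\<rho> > 0" using e B by (simp add: \<rho>_def)
  show "\<exists>r<1. \<forall>z. r < norm z \<longrightarrow> norm z < 1 \<longrightarrow>
      norm (volterra g0 f z) \<le> e * (1 - norm z) powr (-\<gamma>)"
  proof (intro exI[of _ "1 - \<rho>"] conjI allI impI)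
    show "1 - \<rho> < 1" using \<rho> by simp
    fix z :: complex assume z: "1 - \<rho> < norm z" "norm z < 1"
    define s where "s = 1 - norm z"
    have s: "s > 0" "s < \<rho>" using z by (auto simp: s_def)
    have "s powr (\<gamma>/2) \<le> \<rho> powr (\<gamma>/2)"
      using s g by (intro powr_mono2) auto
    also have "\<dots> = e / (2 * B)"
      using g e B by (simp add: \<rho>_def powr_powr)
    finally have "B * s powr (\<gamma>/2) \<le> e / 2"
      using B by (simp add: field_simps)
    moreover have "s powr (-(\<gamma>/2)) = s powr (\<gamma>/2) * s powr (-\<gamma>)"
      by (simp add: powr_add[symmetric])
    ultimately have *: "B * s powr (-(\<gamma>/2)) \<le> e / 2 * s powr (-\<gamma>)"
      using mult_right_mono[of "B * s powr (\<gamma>/2)" "e / 2" "s powr (-\<gamma>)"]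
      by (simp only: mult.assoc powr_ge_zero)
    have "norm (volterra g0 f z) \<le> a / \<gamma> * s powr (-\<gamma>) + K / (\<gamma>/2) * s powr (-(\<gamma>/2))"
      unfolding s_def
      by (rule volterra_g0_bound[OF f g _ less_imp_le[OF a] K(1) K(2)]) (use g z in auto)
    also have "a / \<gamma> = e / 2" using g by (simp add: a_def)
    also have "K / (\<gamma>/2) * s powr (-(\<gamma>/2)) \<le> B * s powr (-(\<gamma>/2))"
      by (rule mult_right_mono) (auto simp: B_def)
    also have "\<dots> \<le> e / 2 * s powr (-\<gamma>)" by (rule *)
    finally show "norm (volterra g0 f z) \<le> e * (1 - norm z) powr (-\<gamma>)"
      by (simp add: s_def)
  qed
qed

lemma cesaro_le_volterra:
  assumes "norm z < 1" "1/2 \<le> norm z"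
  shows "norm (cesaro f z) \<le> 2 * norm (volterra g0 f z)"
proof -
  have "norm (cesaro f z) = norm (volterra g0 f z) / norm z"
    using assms by (subst cesaro_eq) (auto simp: norm_divide)
  also have "\<dots> \<le> norm (volterra g0 f z) / (1/2)"
    using assms by (intro divide_left_mono) auto
  finally show ?thesis by simp
qed

lemma cesaro_maps:
  assumes g: "\<gamma> > 0" and f: "f \<in> growth_space \<gamma>"
  shows "cesaro f \<in> growth_space \<gamma>"
proof -
  have C: "cesaro f \<in> H_disc"
    using f by (intro cesaro_H_disc) (simp add: growth_space_def)
  obtain M where M: "M \<ge> 0"
    "\<And>z. z \<in> ball 0 1 \<Longrightarrow> norm (volterra g0 f z) \<le> M * (1 - norm z) powr (-\<gamma>)"
    using volterra_g0_maps[OF assms] unfolding growth_space_iff by blast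
  obtain K where K: "K \<ge> 0" "\<And>z. norm z \<le> 1/2 \<Longrightarrow> norm (cesaro f z) \<le> K"
    using H_disc_bounded_cball[OF C, of "1/2"] by auto
  have "norm (cesaro f z) \<le> (2 * M + K) * (1 - norm z) powr (-\<gamma>)" if z: "z \<in> ball 0 1" for z
  proof -
    have "1 \<le> (1 - norm z) powr (-\<gamma>)"
      using z g powr_mono2'[of "-\<gamma>" "1 - norm z" 1] by simp
    then have "K \<le> K * (1 - norm z) powr (-\<gamma>)"
      using K(1) mult_left_mono by fastforce
    moreover have "0 \<le> M * (1 - norm z) powr (-\<gamma>)" using M by simp
    ultimately show ?thesis
      using cesaro_le_volterra[of z f] M(2)[of z] K(2)[of z] K(1) z
      by (cases "norm z \<le> 1/2") (auto simp: algebra_simps)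
  qed
  then show ?thesis
    unfolding growth_space_iff using C M(1) K(1)
    by (intro conjI exI[of _ "2 * M + K"]) auto
qed

lemma cesaro_maps0:
  assumes g: "\<gamma> > 0" and f: "f \<in> growth_space0 \<gamma>"
  shows "cesaro f \<in> growth_space0 \<gamma>"
  unfolding growth_space0_iff
proof (intro conjI allI impI)
  show "cesaro f \<in> H_disc"
    using f by (intro cesaro_H_disc) (simp add: growth_space0_def)
  fix e :: real assume "e > 0"
  then have "e / 2 > 0" by simp
  then obtain r where r: "r < 1" "\<And>z. r < norm z \<Longrightarrow> norm z < 1 \<Longrightarrow>
      norm (volterra g0 f z) \<le> e / 2 * (1 - norm z) powr (-\<gamma>)"
    using volterra_g0_maps0[OF assms] unfolding growth_space0_iff by blast
  show "\<exists>r<1. \<forall>z. r < norm z \<longrightarrow> norm z < 1 \<longrightarrow>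
      norm (cesaro f z) \<le> e * (1 - norm z) powr (-\<gamma>)"
  proof (intro exI[of _ "max r (1/2)"] conjI allI impI)
    fix z :: complex assume z: "max r (1/2) < norm z" "norm z < 1"
    then show "norm (cesaro f z) \<le> e * (1 - norm z) powr (-\<gamma>)"
      using cesaro_le_volterra[of z f] r(2)[of z] by simp
  qed (use r in auto)
qed

lemma growth_norm_upper:
  assumes "f \<in> growth_space \<gamma>" "z \<in> ball 0 1"
  shows "(1 - norm z) powr \<gamma> * norm (f z) \<le> growth_norm \<gamma> f"
  using assms unfolding growth_norm_def growth_space_def by (intro cSUP_upper) auto

lemma growth_space_diff:
  assumes "f \<in> growth_space \<gamma>" "g \<in> growth_space \<gamma>"
  shows "(\<lambda>z. f z - g z) \<in> growth_space \<gamma>"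
proof -
  obtain M where M: "M \<ge> 0" "\<And>z. z \<in> ball 0 1 \<Longrightarrow> norm (f z) \<le> M * (1 - norm z) powr (-\<gamma>)"
    using assms(1) unfolding growth_space_iff by blast
  obtain N where N: "N \<ge> 0" "\<And>z. z \<in> ball 0 1 \<Longrightarrow> norm (g z) \<le> N * (1 - norm z) powr (-\<gamma>)"
    using assms(2) unfolding growth_space_iff by blast
  have "norm (f z - g z) \<le> (M + N) * (1 - norm z) powr (-\<gamma>)" if "z \<in> ball 0 1" for z
    using norm_triangle_ineq4[of "f z" "g z"] M(2)[OF that] N(2)[OF that]
    by (simp add: algebra_simps)
  moreover have "(\<lambda>z. f z - g z) \<in> H_disc"
    using assms by (auto simp: H_disc_def growth_space_def intro!: holomorphic_intros)
  ultimately show ?thesis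
    unfolding growth_space_iff using M(1) N(1) by (intro conjI exI[of _ "M + N"]) auto
qed

lemma Metric_space_growth: "Metric_space (growth_space \<gamma>) (growth_dist \<gamma>)"
proof
  have nonneg: "growth_norm \<gamma> f \<ge> 0" if "f \<in> growth_space \<gamma>" for f
    using growth_norm_upper[OF that, of 0] order_trans[OF norm_ge_zero[of "f 0"]] by simp
  show "0 \<le> growth_dist \<gamma> f g" for f g
    by (auto simp: growth_dist_def intro: nonneg growth_space_diff)
  show "growth_dist \<gamma> f g = growth_dist \<gamma> g f" for f g
    by (simp add: growth_dist_def growth_norm_def norm_minus_commute)
  fix f g assume f: "f \<in> growth_space \<gamma>" and g: "g \<in> growth_space \<gamma>"
  show "growth_dist \<gamma> f g = 0 \<longleftrightarrow> f = g"
  proof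
    assume "growth_dist \<gamma> f g = 0"
    then have 0: "growth_norm \<gamma> (\<lambda>z. f z - g z) = 0"
      using f g by (simp add: growth_dist_def)
    show "f = g"
    proof
      fix z
      show "f z = g z"
      proof (cases "z \<in> ball 0 1")
        case True
        then have "(1 - norm z) powr \<gamma> * norm (f z - g z) \<le> 0"
          using growth_norm_upper[OF growth_space_diff[OF f g] True] 0 by simp
        then show ?thesis using True by (simp add: mult_le_0_iff)
      next
        case False
        then show ?thesis using f g by (simp add: growth_space_def H_disc_def)
      qed
    qed
  qed (simp add: growth_dist_def growth_norm_def)
  fix h assume h: "h \<in> growth_space \<gamma>"
  have "growth_norm \<gamma> (\<lambda>z. f z - h z)
      \<le> growth_norm \<gamma> (\<lambda>z. f z - g z) + growth_norm \<gamma> (\<lambda>z. g z - h z)"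
    unfolding growth_norm_def[of \<gamma> "\<lambda>z. f z - h z"]
  proof (rule cSUP_least)
    fix z :: complex assume z: "z \<in> ball 0 1"
    have "norm (f z - h z) \<le> norm (f z - g z) + norm (g z - h z)"
      using norm_triangle_ineq[of "f z - g z" "g z - h z"] by simp
    then have "(1 - norm z) powr \<gamma> * norm (f z - h z)
        \<le> (1 - norm z) powr \<gamma> * norm (f z - g z) + (1 - norm z) powr \<gamma> * norm (g z - h z)"
      by (simp add: distrib_left[symmetric] mult_left_mono)
    then show "(1 - norm z) powr \<gamma> * norm (f z - h z)
        \<le> growth_norm \<gamma> (\<lambda>z. f z - g z) + growth_norm \<gamma> (\<lambda>z. g z - h z)"
      using growth_norm_upper[OF growth_space_diff[OF f g] z]
        growth_norm_upper[OF growth_space_diff[OF g h] z] by linarith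
  qed simp
  then show "growth_dist \<gamma> f h \<le> growth_dist \<gamma> f g + growth_dist \<gamma> g h"
    using f g h by (simp add: growth_dist_def)
qed

lemma Metric_space_growth0:
  assumes "\<gamma> > 0"
  shows "Metric_space (growth_space0 \<gamma>) (growth_dist \<gamma>)"
  using Metric_space.subspace[OF Metric_space_growth growth_space0_subset[OF assms]] .

end

theory Submission
  imports Defs "HOL-Real_Asymp.Real_Asymp"
begin

text \<open>Write \<open>G\<^sub>\<epsilon>(z) = (1 + \<epsilon> + z) powr (-\<beta>)\<close> with \<open>0 < \<beta>\<close> and \<open>\<gamma> - 1 < \<beta> < \<gamma>\<close>. If \<open>C f = G\<close>, or
  equivalently \<open>V f = z G\<close>, then \<open>f = (1 - z) (z G)'\<close>. For \<open>\<epsilon> > 0\<close> this \<open>f\<close> is bounded, so that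
  \<open>G\<^sub>\<epsilon>\<close> and \<open>z G\<^sub>\<epsilon>\<close> lie in the ranges on the small space. They converge in norm to \<open>G\<^sub>0\<close> and
  \<open>z G\<^sub>0\<close>, but for \<open>\<epsilon> = 0\<close> the function \<open>f\<close> grows like \<open>\<bar>1 + z\<bar> powr (-\<beta> - 1)\<close> at \<open>-1\<close>, which is
  too fast even for the large space because \<open>\<beta> + 1 > \<gamma>\<close>.\<close>

section \<open>Test functions with their branch point at or beyond -1\<close>

text \<open>This is \<open>G\<^sub>\<epsilon>\<close>, set to 0 off the disc as membership in
  \<open>H_disc\<close> demands. Its branch point -1 - \<epsilon> lies outside the closed disc for
  \<epsilon> > 0 and on the unit circle for \<epsilon> = 0.\<close>

definition shifted_pole :: "real \<Rightarrow> real \<Rightarrow> complex \<Rightarrow> complex" where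
  "shifted_pole \<beta> \<epsilon> z =
     (if z \<in> ball 0 1 then (1 + of_real \<epsilon> + z) powr (- of_real \<beta>) else 0)"

text \<open>The product (1 - z) (z G)' with the derivative written out, so that growth can be read
  off from the two powers.\<close>

definition pole_preimage :: "real \<Rightarrow> real \<Rightarrow> complex \<Rightarrow> complex" where
  "pole_preimage \<beta> \<epsilon> z =
     (if z \<in> ball 0 1
      then (1 - z) * ((1 + of_real \<epsilon> + z) powr (- of_real \<beta>)
                      - of_real \<beta> * z * (1 + of_real \<epsilon> + z) powr (- of_real \<beta> - 1))
      else 0)"

text \<open>For a real exponent the argument of \<open>w\<close> does not affect the modulus of the
  power, and a nonpositive exponent gives a decreasing function of \<open>norm w\<close>. Keeping
  \<open>p\<close> apart from \<open>of_real a\<close> lets exponents such as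
  \<open>- of_real \<beta> - 1\<close> match.\<close>

lemma norm_powr_le:
  assumes "0 < s" "s \<le> norm (w::complex)" "a \<le> 0" "p = of_real a"
  shows "norm (w powr p) \<le> s powr a"
proof -
  have "norm (w powr p) = norm w powr a"
    using assms(4) by (simp add: norm_powr_real_powr')
  also have "\<dots> \<le> s powr a"
    using assms by (intro powr_mono2') auto
  finally show ?thesis .
qed

text \<open>A bound on the real part, not only on the modulus: it keeps the base of the power off
  the branch cut and places it in a convex half-plane.\<close>

lemma Re_shift_ge:
  fixes z :: complex
  assumes "0 \<le> \<epsilon>"
  shows "\<epsilon> + (1 - norm z) \<le> Re (1 + of_real \<epsilon> + z)"
  using abs_Re_le_cmod[of z] by simp

lemma norm_shift_ge:
  fixes z :: complex
  assumes "0 \<le> \<epsilon>"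
  shows "\<epsilon> + (1 - norm z) \<le> norm (1 + of_real \<epsilon> + z)"
  using Re_shift_ge[OF assms, of z] complex_Re_le_cmod order_trans by blast

lemma shift_notin_nonpos_Reals:
  fixes z :: complex
  assumes "0 \<le> \<epsilon>" "z \<in> ball 0 1"
  shows "1 + of_real \<epsilon> + z \<notin> \<real>\<^sub>\<le>\<^sub>0"
proof -
  have "0 < Re (1 + of_real \<epsilon> + z)"
    using Re_shift_ge[OF assms(1), of z] assms by (simp del: plus_complex.simps)
  then show ?thesis
    by (auto simp: complex_nonpos_Reals_iff)
qed

lemma shifted_pole_H_disc:
  assumes "0 \<le> \<epsilon>"
  shows "shifted_pole \<beta> \<epsilon> \<in> H_disc"
proof -
  have "(\<lambda>z. (1 + of_real \<epsilon> + z) powr (- of_real \<beta>)) holomorphic_on ball 0 1"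
    by (intro holomorphic_intros shift_notin_nonpos_Reals assms)
  then have "shifted_pole \<beta> \<epsilon> holomorphic_on ball 0 1"
    by (rule holomorphic_transform) (simp add: shifted_pole_def)
  then show ?thesis
    by (auto simp: H_disc_def shifted_pole_def)
qed

lemma pole_preimage_H_disc:
  assumes "0 \<le> \<epsilon>"
  shows "pole_preimage \<beta> \<epsilon> \<in> H_disc"
proof -
  have "(\<lambda>z. (1 - z) * ((1 + of_real \<epsilon> + z) powr (- of_real \<beta>)
          - of_real \<beta> * z * (1 + of_real \<epsilon> + z) powr (- of_real \<beta> - 1))) holomorphic_on ball 0 1"
    by (intro holomorphic_intros shift_notin_nonpos_Reals assms)
  then have "pole_preimage \<beta> \<epsilon> holomorphic_on ball 0 1"
    by (rule holomorphic_transform) (simp add: pole_preimage_def)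
  then show ?thesis
    by (auto simp: H_disc_def pole_preimage_def)
qed

section \<open>Preimages under the Volterra and Cesaro operators\<close>

lemma times_id_H_disc: "G \<in> H_disc \<Longrightarrow> (\<lambda>z. z * G z) \<in> H_disc"
  by (auto simp: H_disc_def intro!: holomorphic_intros)

text \<open>This product rule computation explains the formula of \<open>pole_preimage\<close>: the
  integrand occurring in both operators has the primitive z G.\<close>

lemma deriv_times_shifted_pole:
  assumes "0 \<le> \<epsilon>" "z \<in> ball 0 1"
  shows "((\<lambda>z. z * shifted_pole \<beta> \<epsilon> z) has_field_derivative pole_preimage \<beta> \<epsilon> z / (1 - z)) (at z)"
proof -
  let ?w = "1 + of_real \<epsilon> + z"
  have "z \<noteq> 1" using assms(2) by auto
  then have "pole_preimage \<beta> \<epsilon> z / (1 - z)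
      = ?w powr (- of_real \<beta>) - of_real \<beta> * z * ?w powr (- of_real \<beta> - 1)"
    using assms(2) by (simp add: pole_preimage_def)
  moreover have "((\<lambda>z. z * (1 + of_real \<epsilon> + z) powr (- of_real \<beta>)) has_field_derivative
      ?w powr (- of_real \<beta>) - of_real \<beta> * z * ?w powr (- of_real \<beta> - 1)) (at z)"
    by (rule derivative_eq_intros refl shift_notin_nonpos_Reals[OF assms])+ simp
  ultimately have "((\<lambda>z. z * (1 + of_real \<epsilon> + z) powr (- of_real \<beta>))
      has_field_derivative pole_preimage \<beta> \<epsilon> z / (1 - z)) (at z)"
    by simp
  then show ?thesis
    by (rule has_field_derivative_transform_within_open[of _ _ _ "ball 0 1"])
      (use assms in \<open>auto simp: shifted_pole_def\<close>)
qed

text \<open>The primitive z G vanishes at 0, so integrating along the segment from 0 to z leaves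
  exactly its value at z.\<close>

lemma volterra_pole_preimage:
  assumes "0 \<le> \<epsilon>"
  shows "volterra g0 (pole_preimage \<beta> \<epsilon>) = (\<lambda>z. z * shifted_pole \<beta> \<epsilon> z)"
proof
  fix z
  show "volterra g0 (pole_preimage \<beta> \<epsilon>) z = z * shifted_pole \<beta> \<epsilon> z"
  proof (cases "z \<in> ball 0 1")
    case True
    have "((\<lambda>\<xi>. pole_preimage \<beta> \<epsilon> \<xi> / (1 - \<xi>)) has_contour_integral
        pathfinish (linepath 0 z) * shifted_pole \<beta> \<epsilon> (pathfinish (linepath 0 z))
        - pathstart (linepath 0 z) * shifted_pole \<beta> \<epsilon> (pathstart (linepath 0 z))) (linepath 0 z)"
      by (rule contour_integral_primitive[of "ball 0 1" "\<lambda>z. z * shifted_pole \<beta> \<epsilon> z"])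
        (use closed_segment_0_ball[OF True] in
          \<open>simp_all add: has_field_derivative_at_within deriv_times_shifted_pole[OF assms]
             del: linepath_0'\<close>)
    then show ?thesis
      using True by (simp add: volterra_g0_eq contour_integral_unique)
  qed (auto simp: volterra_def shifted_pole_def)
qed

text \<open>Away from 0, divide the Volterra identity by z. At 0 the operator returns the value of
  its argument, and there the term of \<open>pole_preimage\<close> with the factor z drops out,
  leaving that of G.\<close>

lemma cesaro_pole_preimage:
  assumes "0 \<le> \<epsilon>"
  shows "cesaro (pole_preimage \<beta> \<epsilon>) = shifted_pole \<beta> \<epsilon>"
proof
  fix z
  show "cesaro (pole_preimage \<beta> \<epsilon>) z = shifted_pole \<beta> \<epsilon> z"
    using cesaro_eq[of z "pole_preimage \<beta> \<epsilon>"]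
    by (cases "z = 0"; cases "z \<in> ball 0 1")
      (auto simp: volterra_pole_preimage[OF assms] cesaro_def pole_preimage_def shifted_pole_def)
qed

text \<open>Differentiating the equation recovers f z / (1 - z), hence f. Membership of z G in the
  range is thereby reduced to the growth of a single explicit function.\<close>

lemma volterra_eq_pole_imp_preimage:
  assumes "0 \<le> \<epsilon>" "f \<in> H_disc"
    and eq: "\<And>z. z \<in> ball 0 1 \<Longrightarrow> volterra g0 f z = z * shifted_pole \<beta> \<epsilon> z"
  shows "f = pole_preimage \<beta> \<epsilon>"
proof
  fix z
  show "f z = pole_preimage \<beta> \<epsilon> z"
  proof (cases "z \<in> ball 0 1")
    case True
    have "((\<lambda>z. z * shifted_pole \<beta> \<epsilon> z) has_field_derivative f z / (1 - z)) (at z)"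
      by (rule has_field_derivative_transform_within_open[OF volterra_g0_deriv[OF assms(2) True], of "ball 0 1"])
        (use True eq in auto)
    then have "f z / (1 - z) = pole_preimage \<beta> \<epsilon> z / (1 - z)"
      using deriv_times_shifted_pole[OF assms(1) True] by (rule DERIV_unique)
    then show ?thesis using True by auto
  qed (use assms(2) in \<open>auto simp: H_disc_def pole_preimage_def\<close>)
qed

text \<open>Multiplying by z turns this into the Volterra equation; at the origin both sides of the
  latter are 0.\<close>

lemma cesaro_eq_pole_imp_preimage:
  assumes "0 \<le> \<epsilon>" "f \<in> H_disc" and eq: "cesaro f = shifted_pole \<beta> \<epsilon>"
  shows "f = pole_preimage \<beta> \<epsilon>"
proof (rule volterra_eq_pole_imp_preimage[OF assms(1,2)])
  fix z :: complex assume z: "z \<in> ball 0 1"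
  show "volterra g0 f z = z * shifted_pole \<beta> \<epsilon> z"
  proof (cases "z = 0")
    case True
    then show ?thesis by (simp add: volterra_def)
  next
    case False
    then show ?thesis
      using cesaro_eq[OF z False, of f] by (simp add: eq)
  qed
qed

section \<open>Growth of the test functions and of their preimages\<close>

text \<open>With s = 1 - |z|, splitting off \<open>s powr (-\<gamma>)\<close> leaves
  \<open>K * s powr (\<gamma> - \<delta>)\<close>, which tends to 0 with s. Bounded functions are
  the case \<delta> = 0.\<close>

lemma growth_space0_of_slower_growth:
  assumes "f \<in> H_disc" "\<delta> < \<gamma>"
    and bd: "\<And>z. z \<in> ball 0 1 \<Longrightarrow> norm (f z) \<le> K * (1 - norm z) powr (-\<delta>)"
  shows "f \<in> growth_space0 \<gamma>"
  unfolding growth_space0_iff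
proof (intro conjI allI impI)
  fix e :: real assume e: "e > 0"
  have "((\<lambda>s. K * s powr (\<gamma> - \<delta>)) \<longlongrightarrow> K * 0) (at_right 0)"
    using assms(2) by real_asymp
  then have "eventually (\<lambda>s. K * s powr (\<gamma> - \<delta>) < e) (at_right 0)"
    using e by (auto dest: order_tendstoD)
  then obtain b where b: "b > 0" "\<And>s. 0 < s \<Longrightarrow> s < b \<Longrightarrow> K * s powr (\<gamma> - \<delta>) < e"
    unfolding eventually_at_right_field by blast
  show "\<exists>r<1. \<forall>z. r < norm z \<longrightarrow> norm z < 1 \<longrightarrow> norm (f z) \<le> e * (1 - norm z) powr (-\<gamma>)"
  proof (intro exI[of _ "1 - b"] conjI allI impI)
    fix z :: complex assume z: "1 - b < norm z" "norm z < 1"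
    define s where "s = 1 - norm z"
    have "norm (f z) \<le> K * s powr (\<gamma> - \<delta>) * s powr (-\<gamma>)"
      using bd[of z] z by (simp add: s_def mult.assoc flip: powr_add)
    also have "\<dots> \<le> e * s powr (-\<gamma>)"
      using b(2)[of s] z by (intro mult_right_mono) (auto simp: s_def)
    finally show "norm (f z) \<le> e * (1 - norm z) powr (-\<gamma>)"
      by (simp add: s_def)
  qed (use b in auto)
qed (fact assms(1))

text \<open>The modulus of 1 + \<epsilon> + z is at least 1 - |z|; giving up the summand \<epsilon>
  makes the bound uniform in \<epsilon>.\<close>

lemma norm_shifted_pole_le:
  assumes "0 \<le> \<epsilon>" "0 < \<beta>" "z \<in> ball 0 1"
  shows "norm (shifted_pole \<beta> \<epsilon> z) \<le> (1 - norm z) powr (-\<beta>)"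
  unfolding shifted_pole_def
  using assms norm_shift_ge[OF assms(1), of z] by (auto intro!: norm_powr_le)

lemma shifted_pole_growth_space0:
  assumes "0 \<le> \<epsilon>" "0 < \<beta>" "\<beta> < \<gamma>"
  shows "shifted_pole \<beta> \<epsilon> \<in> growth_space0 \<gamma>"
  using growth_space0_of_slower_growth[OF shifted_pole_H_disc[OF assms(1)] assms(3), of \<beta> 1]
    norm_shifted_pole_le[OF assms(1,2)] by simp

lemma times_id_growth_space0:
  assumes "f \<in> growth_space0 \<gamma>"
  shows "(\<lambda>z. z * f z) \<in> growth_space0 \<gamma>"
  unfolding growth_space0_iff
proof (intro conjI allI impI)
  fix e :: real assume "e > 0"
  then obtain r where r: "r < 1"
    "\<And>z. r < norm z \<Longrightarrow> norm z < 1 \<Longrightarrow> norm (f z) \<le> e * (1 - norm z) powr (-\<gamma>)"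
    using assms unfolding growth_space0_iff by blast
  have "norm (z * f z) \<le> norm (f z)" if "norm z < 1" for z
    using that by (simp add: norm_mult mult_left_le_one_le)
  then show "\<exists>r<1. \<forall>z. r < norm z \<longrightarrow> norm z < 1 \<longrightarrow> norm (z * f z) \<le> e * (1 - norm z) powr (-\<gamma>)"
    using r order_trans by blast
qed (use assms in \<open>auto simp: growth_space0_def times_id_H_disc\<close>)

text \<open>On the whole disc the modulus of 1 + \<epsilon> + z is at least \<epsilon>, so both
  powers are bounded and slower growth holds with exponent 0.\<close>

lemma pole_preimage_growth_space0:
  assumes "0 < \<epsilon>" "0 < \<beta>" "0 < \<gamma>"
  shows "pole_preimage \<beta> \<epsilon> \<in> growth_space0 \<gamma>"
proof (rule growth_space0_of_slower_growth)
  show "pole_preimage \<beta> \<epsilon> \<in> H_disc"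
    using assms by (intro pole_preimage_H_disc) auto
  fix z :: complex assume z: "z \<in> ball 0 1"
  define w where "w = 1 + of_real \<epsilon> + z"
  have w: "\<epsilon> \<le> norm w"
    using norm_shift_ge[of \<epsilon> z] z assms by (simp add: w_def)
  have 1: "norm (w powr (- of_real \<beta>)) \<le> \<epsilon> powr (-\<beta>)"
    using w assms by (intro norm_powr_le) auto
  have 2: "norm (w powr (- of_real \<beta> - 1)) \<le> \<epsilon> powr (-\<beta> - 1)"
    using w assms by (intro norm_powr_le) auto
  have "norm (of_real \<beta> * z * w powr (- of_real \<beta> - 1)) \<le> \<beta> * 1 * \<epsilon> powr (-\<beta> - 1)"
    unfolding norm_mult using 2 z assms by (intro mult_mono) auto
  then have 3: "norm (w powr (- of_real \<beta>) - of_real \<beta> * z * w powr (- of_real \<beta> - 1))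
      \<le> \<epsilon> powr (-\<beta>) + \<beta> * \<epsilon> powr (-\<beta> - 1)"
    using 1 norm_triangle_ineq4[of "w powr (- of_real \<beta>)" "of_real \<beta> * z * w powr (- of_real \<beta> - 1)"]
    by simp
  have "norm (1 - z) \<le> 2"
    using norm_triangle_ineq4[of 1 z] z by simp
  then have "norm (pole_preimage \<beta> \<epsilon> z) \<le> 2 * (\<epsilon> powr (-\<beta>) + \<beta> * \<epsilon> powr (-\<beta> - 1))"
    using 3 z unfolding pole_preimage_def w_def[symmetric]
    by (auto simp only: norm_mult if_True intro!: mult_mono norm_ge_zero)
  then show "norm (pole_preimage \<beta> \<epsilon> z)
      \<le> 2 * (\<epsilon> powr (-\<beta>) + \<beta> * \<epsilon> powr (-\<beta> - 1)) * (1 - norm z) powr (- 0)"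
    using z by simp
qed (use assms in auto)

text \<open>On the radius towards -1, at z = s - 1, both powers are positive reals and their
  contributions add up. The more singular one is at least a multiple of
  \<open>s powr (-\<beta> - 1)\<close>, which outgrows
  \<open>M * s powr (-\<gamma>)\<close>.\<close>

lemma pole_preimage_notin_growth_space:
  assumes "0 < \<beta>" "\<gamma> < \<beta> + 1"
  shows "pole_preimage \<beta> 0 \<notin> growth_space \<gamma>"
proof
  assume "pole_preimage \<beta> 0 \<in> growth_space \<gamma>"
  then obtain M where M:
    "\<And>z. z \<in> ball 0 1 \<Longrightarrow> norm (pole_preimage \<beta> 0 z) \<le> M * (1 - norm z) powr (-\<gamma>)"
    unfolding growth_space_iff by blast
  have le: "\<beta> / 2 * s powr (\<gamma> - \<beta> - 1) \<le> M" if s: "0 < s" "s < 1/2" for s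
  proof -
    define z :: complex where "z = of_real (s - 1)"
    have z: "norm z = 1 - s" "z \<in> ball 0 1"
      using s unfolding z_def mem_ball_0 norm_of_real by auto
    have "pole_preimage \<beta> 0 z
        = of_real ((2 - s) * (s powr (-\<beta>) + \<beta> * (1 - s) * s powr (-\<beta> - 1)))"
    proof -
      have "of_real s powr (- of_real \<beta>) = complex_of_real (s powr (-\<beta>))"
        "of_real s powr (- of_real \<beta> - 1) = complex_of_real (s powr (-\<beta> - 1))"
        using s powr_of_real[of s "-\<beta>"] powr_of_real[of s "-\<beta> - 1"] by auto
      then show ?thesis
        using z(2) unfolding pole_preimage_def by (simp add: z_def algebra_simps)
    qed
    \<comment> \<open>Since s < 1/2, the factors 2 - s and 1 - s are at least 1 and 1/2; the milder
      power is bounded below by 0.\<close>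
    moreover have "1 * (0 + \<beta> * (1/2) * s powr (-\<beta> - 1))
        \<le> (2 - s) * (s powr (-\<beta>) + \<beta> * (1 - s) * s powr (-\<beta> - 1))"
      using s assms by (intro mult_mono add_mono) auto
    ultimately have "\<beta> / 2 * s powr (-\<beta> - 1) \<le> norm (pole_preimage \<beta> 0 z)"
      by (simp del: of_real_mult of_real_add of_real_diff of_real_numeral)
    also have "\<dots> \<le> M * s powr (-\<gamma>)"
      using M[OF z(2)] z(1) by simp
    finally have "\<beta> / 2 * s powr (-\<beta> - 1) * s powr \<gamma> \<le> M * s powr (-\<gamma>) * s powr \<gamma>"
      by (rule mult_right_mono) simp
    moreover have "s powr (-\<beta> - 1) * s powr \<gamma> = s powr (\<gamma> - \<beta> - 1)" "s powr (-\<gamma>) * s powr \<gamma> = 1"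
      using s powr_add[of s "-\<beta> - 1" \<gamma>] powr_add[of s "-\<gamma>" \<gamma>] by (simp_all add: algebra_simps)
    ultimately show ?thesis
      by (simp only: mult.assoc mult_1_right)
  qed
  \<comment> \<open>The exponent is negative, so the left side of \<open>le\<close> is unbounded as
    s decreases to 0.\<close>
  have "filterlim (\<lambda>s. \<beta> / 2 * s powr (\<gamma> - \<beta> - 1)) at_top (at_right 0)"
    using assms by real_asymp
  then have "eventually (\<lambda>s. M < \<beta> / 2 * s powr (\<gamma> - \<beta> - 1)) (at_right 0)"
    unfolding filterlim_at_top_dense by blast
  moreover have "eventually (\<lambda>s. 0 < s \<and> s < 1/2) (at_right (0::real))"
    unfolding eventually_at_right_field by (intro exI[of _ "1/2"]) auto
  ultimately have "eventually (\<lambda>s::real. False) (at_right 0)"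
    by eventually_elim (use le in fastforce)
  then show False by simp
qed

section \<open>Norm convergence as \<epsilon> tends to 0\<close>

text \<open>Mean value inequality for \<open>w powr (-\<beta>)\<close> on the half-plane of real
  part at least 1 - |z|: it is convex, contains both bases, which differ by \<epsilon>, and bounds
  the derivative by its value at the edge.\<close>

lemma shifted_pole_diff_le:
  assumes "0 < \<epsilon>" "0 < \<beta>" "z \<in> ball 0 1"
  shows "norm (shifted_pole \<beta> 0 z - shifted_pole \<beta> \<epsilon> z) \<le> \<beta> * \<epsilon> * (1 - norm z) powr (-\<beta> - 1)"
proof -
  define s where "s = 1 - norm z"
  have s: "s > 0" using assms by (simp add: s_def)
  have "norm ((1 + z) powr (- of_real \<beta>) - (1 + of_real \<epsilon> + z) powr (- of_real \<beta>))
      \<le> \<beta> * s powr (-\<beta> - 1) * norm ((1 + z) - (1 + of_real \<epsilon> + z))"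
  proof (rule field_differentiable_bound[where S = "{w. Re w \<ge> s}"
        and f' = "\<lambda>w. - of_real \<beta> * w powr (- of_real \<beta> - 1)"])
    show "convex {w. Re w \<ge> s}" by (rule convex_halfspace_Re_ge)
    fix w assume "w \<in> {w. Re w \<ge> s}"
    then have w: "Re w \<ge> s" by simp
    then have "w \<notin> \<real>\<^sub>\<le>\<^sub>0" using s by (auto simp: complex_nonpos_Reals_iff)
    then show "((\<lambda>w. w powr (- of_real \<beta>)) has_field_derivative
        - of_real \<beta> * w powr (- of_real \<beta> - 1)) (at w within {w. Re w \<ge> s})"
      by (rule has_field_derivative_at_within[OF has_field_derivative_powr])
    have "norm (w powr (- of_real \<beta> - 1)) \<le> s powr (-\<beta> - 1)"
      using s w complex_Re_le_cmod[of w] assms by (intro norm_powr_le) auto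
    then show "norm (- of_real \<beta> * w powr (- of_real \<beta> - 1)) \<le> \<beta> * s powr (-\<beta> - 1)"
      using assms by (simp add: norm_mult)
  next
    show "1 + z \<in> {w. Re w \<ge> s}" "1 + of_real \<epsilon> + z \<in> {w. Re w \<ge> s}"
      using Re_shift_ge[of 0 z] Re_shift_ge[of \<epsilon> z] assms(1) by (auto simp: s_def)
  qed
  then show ?thesis
    using assms by (simp add: shifted_pole_def s_def mult_ac)
qed

text \<open>For \<open>1 - \<bar>z\<bar> \<le> \<epsilon>\<close> the two poles are estimated separately, otherwise by the mean value
  inequality; both give a multiple of \<open>\<epsilon> powr (\<gamma> - \<beta>)\<close>.\<close>

lemma shifted_pole_weighted_diff_le:
  assumes "0 < \<epsilon>" "0 < \<beta>" "\<beta> < \<gamma>" "\<gamma> < \<beta> + 1" "z \<in> ball 0 1"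
  shows "(1 - norm z) powr \<gamma> * norm (shifted_pole \<beta> 0 z - shifted_pole \<beta> \<epsilon> z)
    \<le> (2 + \<beta>) * \<epsilon> powr (\<gamma> - \<beta>)"
proof -
  define s where "s = 1 - norm z"
  define D where "D = norm (shifted_pole \<beta> 0 z - shifted_pole \<beta> \<epsilon> z)"
  have s: "s > 0" using assms by (simp add: s_def)
  have "s powr \<gamma> * D \<le> (2 + \<beta>) * \<epsilon> powr (\<gamma> - \<beta>)"
  proof (cases "s \<le> \<epsilon>")
    case True
    have "D \<le> 2 * s powr (-\<beta>)"
      using norm_triangle_ineq4[of "shifted_pole \<beta> 0 z" "shifted_pole \<beta> \<epsilon> z"]
        norm_shifted_pole_le[of 0 \<beta> z] norm_shifted_pole_le[of \<epsilon> \<beta> z] assms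
      by (simp add: D_def s_def)
    then have "s powr \<gamma> * D \<le> s powr \<gamma> * (2 * s powr (-\<beta>))"
      by (rule mult_left_mono) simp
    also have "\<dots> = 2 * s powr (\<gamma> - \<beta>)"
      using powr_add[of s \<gamma> "-\<beta>"] by simp
    also have "\<dots> \<le> (2 + \<beta>) * \<epsilon> powr (\<gamma> - \<beta>)"
      using True s assms by (intro mult_mono powr_mono2) auto
    finally show ?thesis .
  next
    case False
    have "s powr \<gamma> * D \<le> s powr \<gamma> * (\<beta> * \<epsilon> * s powr (-\<beta> - 1))"
      using shifted_pole_diff_le[OF assms(1,2,5)]
      by (intro mult_left_mono) (auto simp: D_def s_def)
    also have "\<dots> = \<beta> * (\<epsilon> * s powr (\<gamma> - \<beta> - 1))"
      using powr_add[of s \<gamma> "-\<beta> - 1"] by (simp add: algebra_simps)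
    \<comment> \<open>Here s > \<epsilon> and the exponent \<gamma> - \<beta> - 1 is negative, so
      replacing s by \<epsilon> increases the power.\<close>
    also have "\<dots> \<le> (2 + \<beta>) * (\<epsilon> * \<epsilon> powr (\<gamma> - \<beta> - 1))"
      using False assms by (intro mult_mono powr_mono2') auto
    also have "\<epsilon> * \<epsilon> powr (\<gamma> - \<beta> - 1) = \<epsilon> powr (\<gamma> - \<beta>)"
      using powr_add[of \<epsilon> 1 "\<gamma> - \<beta> - 1"] assms(1) by simp
    finally show ?thesis .
  qed
  then show ?thesis by (simp add: s_def D_def)
qed

lemma growth_dist_le:
  assumes "f \<in> growth_space \<gamma>" "g \<in> growth_space \<gamma>"
    and "\<And>z. z \<in> ball 0 1 \<Longrightarrow> (1 - norm z) powr \<gamma> * norm (f z - g z) \<le> B"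
  shows "growth_dist \<gamma> f g \<le> B"
proof -
  have "growth_norm \<gamma> (\<lambda>z. f z - g z) \<le> B"
    unfolding growth_norm_def by (rule cSUP_least) (use assms in auto)
  then show ?thesis using assms by (simp add: growth_dist_def)
qed

section \<open>Failure of closedness for both spaces\<close>

text \<open>One limit serves both spaces: G is missed by the image of the large space, hence of the
  small one, while the approximants are images of elements of the small space, hence of either.
  Every ball about G thus meets the image.\<close>

lemma not_closedin_image:
  assumes "0 < \<gamma>"
    and X: "X = growth_space \<gamma> \<or> X = growth_space0 \<gamma>"
    and G: "G \<in> growth_space0 \<gamma>" "G \<notin> T ` growth_space \<gamma>"
    and approx: "\<And>e. e > 0 \<Longrightarrow>
      \<exists>f \<in> growth_space0 \<gamma>. T f \<in> growth_space0 \<gamma> \<and> growth_dist \<gamma> G (T f) < e"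
  shows "\<not> closedin (Metric_space.mtopology X (growth_dist \<gamma>)) (T ` X)"
proof
  note sub = growth_space0_subset[OF \<open>0 < \<gamma>\<close>]
  have X': "growth_space0 \<gamma> \<subseteq> X" "X \<subseteq> growth_space \<gamma>"
    using X sub by auto
  interpret Metric_space X "growth_dist \<gamma>"
    using X Metric_space_growth Metric_space_growth0[OF \<open>0 < \<gamma>\<close>] by auto
  assume "closedin mtopology (T ` X)"
  moreover have "G \<in> X - T ` X"
    using G X' by blast
  ultimately obtain e where e: "e > 0" "disjnt (T ` X) (mball G e)"
    unfolding closedin_metric by blast
  obtain f where f: "f \<in> growth_space0 \<gamma>" "T f \<in> growth_space0 \<gamma>" "growth_dist \<gamma> G (T f) < e"
    using approx[OF e(1)] by blast
  then have "T f \<in> mball G e"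
    using G X' by (auto simp: in_mball)
  then show False
    using e(2) f(1) X' by (auto simp: disjnt_iff)
qed

theorem proposition5p7:
  fixes \<gamma> :: real
  assumes "\<gamma> > 0"
  shows "(\<not> closedin (Metric_space.mtopology (growth_space \<gamma>) (growth_dist \<gamma>))
              (cesaro ` growth_space \<gamma>) \<and>
          \<not> closedin (Metric_space.mtopology (growth_space0 \<gamma>) (growth_dist \<gamma>))
              (cesaro ` growth_space0 \<gamma>)) \<and>
         (\<not> closedin (Metric_space.mtopology (growth_space \<gamma>) (growth_dist \<gamma>))
              (volterra g0 ` growth_space \<gamma>) \<and>
          \<not> closedin (Metric_space.mtopology (growth_space0 \<gamma>) (growth_dist \<gamma>))
              (volterra g0 ` growth_space0 \<gamma>))"
proof -
  \<comment> \<open>\<beta> < \<gamma> puts the limit in the small space and makes the distances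
    tend to 0; \<gamma> < \<beta> + 1 expels its preimage from the large space.\<close>
  obtain \<beta> where \<beta>: "0 < \<beta>" "\<beta> < \<gamma>" "\<gamma> < \<beta> + 1"
    using dense[of "max 0 (\<gamma> - 1)" \<gamma>] assms by auto
  have pole: "shifted_pole \<beta> \<epsilon> \<in> growth_space0 \<gamma>"
    and zpole: "(\<lambda>z. z * shifted_pole \<beta> \<epsilon> z) \<in> growth_space0 \<gamma>" if "0 \<le> \<epsilon>" for \<epsilon>
    using shifted_pole_growth_space0[OF that \<beta>(1,2)] times_id_growth_space0 by auto
  note in_growth = subsetD[OF growth_space0_subset[OF assms]]
  have dist: "growth_dist \<gamma> (shifted_pole \<beta> 0) (shifted_pole \<beta> \<epsilon>) \<le> (2 + \<beta>) * \<epsilon> powr (\<gamma> - \<beta>)"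
    and zdist: "growth_dist \<gamma> (\<lambda>z. z * shifted_pole \<beta> 0 z) (\<lambda>z. z * shifted_pole \<beta> \<epsilon> z)
      \<le> (2 + \<beta>) * \<epsilon> powr (\<gamma> - \<beta>)" if \<epsilon>: "0 < \<epsilon>" for \<epsilon>
  proof -
    note bound = shifted_pole_weighted_diff_le[OF \<epsilon> \<beta>]
    show "growth_dist \<gamma> (shifted_pole \<beta> 0) (shifted_pole \<beta> \<epsilon>) \<le> (2 + \<beta>) * \<epsilon> powr (\<gamma> - \<beta>)"
      using \<epsilon> by (intro growth_dist_le in_growth pole bound) auto
    show "growth_dist \<gamma> (\<lambda>z. z * shifted_pole \<beta> 0 z) (\<lambda>z. z * shifted_pole \<beta> \<epsilon> z)
      \<le> (2 + \<beta>) * \<epsilon> powr (\<gamma> - \<beta>)"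
    proof (intro growth_dist_le in_growth zpole)
      fix z :: complex assume z: "z \<in> ball 0 1"
      \<comment> \<open>Multiplication by z does not increase the modulus on the disc, so the rate
        for G carries over to z G.\<close>
      have "norm (z * shifted_pole \<beta> 0 z - z * shifted_pole \<beta> \<epsilon> z)
          \<le> norm (shifted_pole \<beta> 0 z - shifted_pole \<beta> \<epsilon> z)"
        using z by (simp add: norm_mult mult_left_le_one_le flip: right_diff_distrib)
      then show "(1 - norm z) powr \<gamma> * norm (z * shifted_pole \<beta> 0 z - z * shifted_pole \<beta> \<epsilon> z)
          \<le> (2 + \<beta>) * \<epsilon> powr (\<gamma> - \<beta>)"
        using bound[OF z] by (meson mult_left_mono order_trans powr_ge_zero)
    qed (use \<epsilon> in auto)
  qed
  have small: "\<exists>\<epsilon>>0. (2 + \<beta>) * \<epsilon> powr (\<gamma> - \<beta>) < e" if "e > 0" for e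
  proof -
    have "((\<lambda>\<epsilon>. (2 + \<beta>) * \<epsilon> powr (\<gamma> - \<beta>)) \<longlongrightarrow> 0) (at_right 0)"
      using \<beta> by real_asymp
    then have "eventually (\<lambda>\<epsilon>. (2 + \<beta>) * \<epsilon> powr (\<gamma> - \<beta>) < e) (at_right 0)"
      using that by (auto dest: order_tendstoD)
    then show ?thesis
      unfolding eventually_at_right_field using dense by blast
  qed
  have "\<not> closedin (Metric_space.mtopology X (growth_dist \<gamma>)) (cesaro ` X)"
    if "X = growth_space \<gamma> \<or> X = growth_space0 \<gamma>" for X
  proof (rule not_closedin_image[OF assms that pole[of 0]])
    show "shifted_pole \<beta> 0 \<notin> cesaro ` growth_space \<gamma>"
    proof
      assume "shifted_pole \<beta> 0 \<in> cesaro ` growth_space \<gamma>"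
      then obtain f where "f \<in> growth_space \<gamma>" "cesaro f = shifted_pole \<beta> 0"
        by auto
      then show False
        using cesaro_eq_pole_imp_preimage[of 0 f \<beta>] pole_preimage_notin_growth_space[OF \<beta>(1,3)]
        by (auto simp: growth_space_def)
    qed
    fix e :: real assume "e > 0"
    then obtain \<epsilon> where \<epsilon>: "0 < \<epsilon>" "(2 + \<beta>) * \<epsilon> powr (\<gamma> - \<beta>) < e"
      using small by blast
    show "\<exists>f \<in> growth_space0 \<gamma>. cesaro f \<in> growth_space0 \<gamma> \<and>
        growth_dist \<gamma> (shifted_pole \<beta> 0) (cesaro f) < e"
      using \<epsilon> pole[of \<epsilon>] dist[of \<epsilon>] pole_preimage_growth_space0[OF \<epsilon>(1) \<beta>(1) assms]
      by (intro bexI[of _ "pole_preimage \<beta> \<epsilon>"]) (auto simp: cesaro_pole_preimage)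
  qed simp
  \<comment> \<open>The limit is now z G: every value of the Volterra operator vanishes at 0,
    whereas G does not.\<close>
  moreover have "\<not> closedin (Metric_space.mtopology X (growth_dist \<gamma>)) (volterra g0 ` X)"
    if "X = growth_space \<gamma> \<or> X = growth_space0 \<gamma>" for X
  proof (rule not_closedin_image[OF assms that zpole[of 0]])
    show "(\<lambda>z. z * shifted_pole \<beta> 0 z) \<notin> volterra g0 ` growth_space \<gamma>"
    proof
      assume "(\<lambda>z. z * shifted_pole \<beta> 0 z) \<in> volterra g0 ` growth_space \<gamma>"
      then obtain f where f: "f \<in> growth_space \<gamma>" "volterra g0 f = (\<lambda>z. z * shifted_pole \<beta> 0 z)"
        by auto
      then have "f = pole_preimage \<beta> 0"
        by (intro volterra_eq_pole_imp_preimage) (auto simp: growth_space_def)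
      then show False
        using f(1) pole_preimage_notin_growth_space[OF \<beta>(1,3)] by simp
    qed
    fix e :: real assume "e > 0"
    then obtain \<epsilon> where \<epsilon>: "0 < \<epsilon>" "(2 + \<beta>) * \<epsilon> powr (\<gamma> - \<beta>) < e"
      using small by blast
    show "\<exists>f \<in> growth_space0 \<gamma>. volterra g0 f \<in> growth_space0 \<gamma> \<and>
        growth_dist \<gamma> (\<lambda>z. z * shifted_pole \<beta> 0 z) (volterra g0 f) < e"
      using \<epsilon> zpole[of \<epsilon>] zdist[of \<epsilon>] pole_preimage_growth_space0[OF \<epsilon>(1) \<beta>(1) assms]
      by (intro bexI[of _ "pole_preimage \<beta> \<epsilon>"]) (auto simp: volterra_pole_preimage)
  qed simp
  ultimately show ?thesis by blast
qed

end
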